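(* Let $G$ be a finite undirected graph whose vertex set is partitioned into two sets $S$ and $Y$, and let $\mathcal{F}=(P_1,\dots,P_{2|Y|+1})$ be a sequence of (not necessarily distinct) directed $S$–$S$ paths in $G$. Then there exists a directed $S$–$S$ path in $G$ that is rainbow-monotone with respect to $\mathcal{F}$.
   Context: Paths are (simple) paths in the undirected graph $G$, traversed in a chosen direction; $in(P)$ and $ter(P)$ denote the initial and terminal vertices of a directed path $P$. A directed $S$–$S$ path is a directed path $P$ (with at least one edge) with $in(P),ter(P)\in S$ and $V(P)\cap S=\{in(P),ter(P)\}$. Given an ordered family $\mathcal{F}=(P_1,\dots,P_m)$ of directed paths, a directed path $P$ whose edges, in the order of $P$, are $e_1,\dots,e_k$ is rainbow-monotone with respect to $\mathcal{F}$ if there are indices $j_1<j_2<\dots<j_k$ with $e_i\in E(P_{j_i})$ for every $i$. *)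

theory Defs
  imports "Graph_Theory.Arc_Walk"
begin

text \<open>
  Undirected graphs are represented, as in Graph_Theory, by the locale \<^locale>\<open>graph\<close>:
  finite simple symmetric digraphs, where an undirected edge \<open>{u, v}\<close> is a pair of opposite
  arcs. A directed path is a list of arcs satisfying \<open>apath\<close>; the arc of an edge records
  the direction in which the path traverses it.
\<close>

definition directed_SS_path :: "('a, 'b) pre_digraph \<Rightarrow> 'a set \<Rightarrow> 'b list \<Rightarrow> bool" where
  "directed_SS_path G S p \<longleftrightarrow>
     p \<noteq> [] \<and>
     (\<exists>u v. pre_digraph.apath G u p v \<and> u \<in> S \<and> v \<in> S \<and>
            set (pre_digraph.awalk_verts G u p) \<inter> S = {u, v})"

text \<open>
  The edges of a directed path are its arcs, so an edge of \<open>p\<close> taken from the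
  path \<open>F ! j i\<close> is traversed in the same direction by both. Ignoring directions here would
  give a weaker notion.
\<close>

definition rainbow_monotone :: "'b list list \<Rightarrow> 'b list \<Rightarrow> bool" where
  "rainbow_monotone F p \<longleftrightarrow>
     (\<exists>j :: nat \<Rightarrow> nat. strict_mono_on {..<length p} j \<and>
        (\<forall>i < length p. j i < length F \<and> p ! i \<in> set (F ! j i)))"

end

(* For each vertex y in Y record the set of sources s in S from which y is reached by a path
   with interior in Y that is rainbow-monotone with respect to the first t members of the family.
   Truncate the size of this set at 2.  If the next path P, from s to s', changes none of the
   truncated sizes, then by induction along P every vertex of P before s' has s among its sources
   or has at least two sources; either way the last vertex before s' has a source other than s',
   and the last arc of P completes a rainbow-monotone S-S path.  Otherwise the sum over Y of the
   truncated sizes grows, which happens at most 2|Y| times. *)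
theory Submission
  imports Defs
begin

lemma rainbow_monotone_Nil: "rainbow_monotone F []"
  by (auto simp: rainbow_monotone_def strict_mono_on_def)

lemma rainbow_monotone_append_family:
  assumes "rainbow_monotone F p"
  shows "rainbow_monotone (F @ F') p"
  using assms unfolding rainbow_monotone_def by (fastforce simp: nth_append)

lemma rainbow_monotone_prefix:
  assumes "rainbow_monotone F (p @ q)"
  shows "rainbow_monotone F p"
proof -
  obtain j where j: "strict_mono_on {..<length (p @ q)} j"
    "\<forall>i<length (p @ q). j i < length F \<and> (p @ q) ! i \<in> set (F ! j i)"
    using assms unfolding rainbow_monotone_def by blast
  have "strict_mono_on {..<length p} j"
    using j(1) by (auto simp: strict_mono_on_def)
  moreover have "j i < length F \<and> p ! i \<in> set (F ! j i)" if "i < length p" for i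
    using j(2)[rule_format, of i] that by (simp add: nth_append)
  ultimately show ?thesis
    unfolding rainbow_monotone_def by blast
qed

lemma rainbow_monotone_snoc:
  assumes "rainbow_monotone F p" and "a \<in> set P"
  shows "rainbow_monotone (F @ [P]) (p @ [a])"
proof -
  obtain j where j: "strict_mono_on {..<length p} j"
    "\<And>i. i < length p \<Longrightarrow> j i < length F \<and> p ! i \<in> set (F ! j i)"
    using assms(1) unfolding rainbow_monotone_def by blast
  \<comment> \<open>The new arc takes the index of \<open>P\<close>, which exceeds every index used
    for \<open>p\<close>, so \<open>k\<close> stays strictly increasing.\<close>
  define k where "k = j(length p := length F)"
  have "strict_mono_on {..<length (p @ [a])} k"
    using j by (auto simp: strict_mono_on_def k_def)
  moreover have "k i < length (F @ [P]) \<and> (p @ [a]) ! i \<in> set ((F @ [P]) ! k i)"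
    if "i < length (p @ [a])" for i
    using j(2)[of i] that assms(2) by (auto simp: nth_append k_def less_Suc_eq)
  ultimately show ?thesis
    unfolding rainbow_monotone_def by blast
qed

text \<open>The vertex \<open>y\<close> may also lie in \<open>S\<close>: then the trace condition
  forces \<open>s = y\<close> and \<open>p = []\<close>. This lets the induction along a path of the
  family start at its first vertex.\<close>

definition (in pre_digraph) rainbow_sources :: "'a set \<Rightarrow> 'b list list \<Rightarrow> 'a \<Rightarrow> 'a set" where
  "rainbow_sources S F y = {s \<in> S. \<exists>p. apath s p y \<and> set (awalk_verts s p) \<inter> S = {s} \<and>
     rainbow_monotone F p}"

context wf_digraph
begin

lemma awalk_verts_snoc:
  "awalk u (p @ [a]) v \<Longrightarrow> awalk_verts u (p @ [a]) = awalk_verts u p @ [head G a]"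
  by (simp add: awalk_verts_append del: awalk_append_iff)

lemma apath_snocI:
  assumes "apath u p (tail G a)" and "a \<in> arcs G" and "head G a \<notin> set (awalk_verts u p)"
  shows "apath u (p @ [a]) (head G a)"
proof -
  have "awalk u (p @ [a]) (head G a)"
    using assms by (auto simp: apath_def intro: awalk_appendI arc_implies_awalk)
  then show ?thesis
    using assms by (auto simp: apath_def awalk_verts_snoc)
qed

lemma rainbow_sources_subset: "rainbow_sources S F y \<subseteq> S"
  by (auto simp: rainbow_sources_def)

lemma rainbow_sources_self:
  "s \<in> S \<Longrightarrow> s \<in> verts G \<Longrightarrow> s \<in> rainbow_sources S F s"
  by (auto simp: rainbow_sources_def apath_Nil_iff rainbow_monotone_Nil intro!: exI[of _ "[]"])

lemma rainbow_sources_append_family: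
  "rainbow_sources S F y \<subseteq> rainbow_sources S (F @ F') y"
  unfolding rainbow_sources_def using rainbow_monotone_append_family by blast

text \<open>A path to the tail of \<open>a\<close> is extended by \<open>a\<close>, with
  \<open>P\<close> supplying the last index. If the head of \<open>a\<close> already lies on the
  path, the path is cut there instead, and a prefix stays rainbow-monotone.\<close>

lemma rainbow_sources_step:
  assumes "a \<in> set P" and "a \<in> arcs G" and "head G a \<notin> S"
  shows "rainbow_sources S F (tail G a) \<subseteq> rainbow_sources S (F @ [P]) (head G a)"
proof
  fix s assume "s \<in> rainbow_sources S F (tail G a)"
  then obtain p where s: "s \<in> S" and p: "apath s p (tail G a)"
    "set (awalk_verts s p) \<inter> S = {s}" "rainbow_monotone F p"
    by (auto simp: rainbow_sources_def)
  show "s \<in> rainbow_sources S (F @ [P]) (head G a)"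
  proof (cases "head G a \<in> set (awalk_verts s p)")
    case True
    then obtain q r where qr: "p = q @ r" "awalk s q (head G a)"
      using awalk_decomp p(1) by (metis awalkI_apath)
    have q: "apath s q (head G a)"
      using p(1) qr apath_append_iff[of s q r "tail G a"] by auto
    have "set (awalk_verts s q) \<subseteq> set (awalk_verts s p)"
      using p(1) qr(1) by (auto simp: apath_def awalk_verts_append simp del: awalk_append_iff)
    then have "set (awalk_verts s q) \<inter> S = {s}"
      using p(2) s hd_in_awalk_verts(2)[OF q] by blast
    moreover have "rainbow_monotone (F @ [P]) q"
      using p(3) qr(1) rainbow_monotone_prefix rainbow_monotone_append_family by blast
    ultimately show ?thesis
      using s q by (auto simp: rainbow_sources_def)
  next
    case False
    have ap: "apath s (p @ [a]) (head G a)"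
      using p(1) assms(2) False by (rule apath_snocI)
    have "set (awalk_verts s (p @ [a])) \<inter> S = {s}"
      using ap p(2) assms(3) by (simp add: awalk_verts_snoc[OF awalkI_apath[OF ap]])
    then show ?thesis
      using s ap rainbow_monotone_snoc[OF p(3) assms(1)] by (auto simp: rainbow_sources_def)
  qed
qed

lemma rainbow_sources_imp_SS_path:
  assumes "s \<in> rainbow_sources S F (tail G a)" and "s \<noteq> head G a"
    and "a \<in> set P" and "a \<in> arcs G" and "head G a \<in> S"
  shows "\<exists>p. directed_SS_path G S p \<and> rainbow_monotone (F @ [P]) p"
proof -
  obtain p where s: "s \<in> S" and p: "apath s p (tail G a)"
    "set (awalk_verts s p) \<inter> S = {s}" "rainbow_monotone F p"
    using assms(1) by (auto simp: rainbow_sources_def)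
  \<comment> \<open>The head of \<open>a\<close> is in \<open>S\<close> and differs from
    \<open>s\<close>, the only vertex of \<open>p\<close> in \<open>S\<close>, so it is not on
    \<open>p\<close>.\<close>
  have ap: "apath s (p @ [a]) (head G a)"
    using p assms(2,4,5) by (intro apath_snocI) auto
  have "set (awalk_verts s (p @ [a])) \<inter> S = {s, head G a}"
    using p(2) assms(5) by (auto simp: awalk_verts_snoc[OF awalkI_apath[OF ap]])
  then have "directed_SS_path G S (p @ [a])"
    using s ap assms(5) by (auto simp: directed_SS_path_def)
  then show ?thesis
    using rainbow_monotone_snoc[OF p(3) assms(3)] by blast
qed

text \<open>Each arc of \<open>q\<close> passes the sources of its tail, computed from
  \<open>F\<close>, to its head, computed from \<open>F @ [P]\<close>. Stability brings them back to
  \<open>F\<close>, so the next arc can be treated with the same \<open>P\<close>.\<close>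

lemma rainbow_sources_along_walk:
  assumes "finite S" and "s \<in> S"
    and stable: "\<And>y. y \<in> verts G - S \<Longrightarrow>
      min 2 (card (rainbow_sources S (F @ [P]) y)) = min 2 (card (rainbow_sources S F y))"
    and "awalk s q v" and "set q \<subseteq> set P" and "head G ` set q \<inter> S = {}"
  shows "s \<in> rainbow_sources S F v \<or> 2 \<le> card (rainbow_sources S F v)"
  using assms(4-6)
proof (induction q arbitrary: v rule: rev_induct)
  case Nil
  then show ?case
    using rainbow_sources_self[OF assms(2)] by (auto simp: awalk_Nil_iff)
next
  case (snoc a q)
  let ?R = "rainbow_sources S F" and ?R' = "rainbow_sources S (F @ [P])"
  have a: "a \<in> arcs G" "v = head G a" "awalk s q (tail G a)"
    using snoc.prems(1) by (auto simp: awalk_simps)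
  have IH: "s \<in> ?R (tail G a) \<or> 2 \<le> card (?R (tail G a))"
    using a(3) snoc.prems by (intro snoc.IH) auto
  have fin: "finite (?R' v)"
    using assms(1) rainbow_sources_subset finite_subset by metis
  have mono: "?R v \<subseteq> ?R' v"
    by (rule rainbow_sources_append_family)
  have step: "?R (tail G a) \<subseteq> ?R' v"
    using rainbow_sources_step[of a P S F] a snoc.prems by auto
  have "v \<in> verts G - S"
    using a snoc.prems by auto
  then have eq: "min 2 (card (?R' v)) = min 2 (card (?R v))"
    by (rule stable)
  show ?case
  proof (cases "2 \<le> card (?R v)")
    case False
    \<comment> \<open>Below 2 the truncation has no effect, so equal truncated sizes mean equal
      sizes, and the inclusion \<open>mono\<close> becomes an equality.\<close>
    then have "card (?R v) = card (?R' v)"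
      using eq by linarith
    then have "?R v = ?R' v"
      using mono fin by (simp add: card_subset_eq)
    with IH step fin False show ?thesis
      using card_mono[OF fin step] by auto
  qed simp
qed

lemma rainbow_SS_path_or_sources_grow:
  assumes "finite S" and "directed_SS_path G S P"
    and no_path: "\<nexists>p. directed_SS_path G S p \<and> rainbow_monotone (F @ [P]) p"
  shows "\<exists>y \<in> verts G - S.
    min 2 (card (rainbow_sources S F y)) < min 2 (card (rainbow_sources S (F @ [P]) y))"
proof (rule ccontr)
  let ?R = "rainbow_sources S F" and ?R' = "rainbow_sources S (F @ [P])"
  assume no_growth: "\<not> ?thesis"
  have stable: "min 2 (card (?R' y)) = min 2 (card (?R y))" if "y \<in> verts G - S" for y
  proof -
    have "finite (?R' y)"
      using assms(1) rainbow_sources_subset finite_subset by metis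
    then have "card (?R y) \<le> card (?R' y)"
      by (intro card_mono rainbow_sources_append_family)
    with no_growth that show ?thesis
      by (metis le_less min.mono order_refl)
  qed
  obtain s t where P: "P \<noteq> []" "apath s P t" "s \<in> S" "t \<in> S"
    "set (awalk_verts s P) \<inter> S = {s, t}"
    using assms(2) unfolding directed_SS_path_def by blast
  obtain q a where qa: "P = q @ [a]"
    using P(1) by (metis rev_exhaust)
  have w: "awalk s q (tail G a)" and a: "a \<in> arcs G" "head G a = t"
    using awalkI_apath[OF P(2)] unfolding qa by (auto simp: awalk_simps)
  have verts: "awalk_verts s P = s # map (head G) q @ [t]"
    using awalk_verts_conv'[of s P t] P(1) awalkI_apath[OF P(2)] qa a(2)
    by (cases q) (auto simp: awalk_def)
  then have distinct: "distinct (s # map (head G) q @ [t])"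
    using P(2) by (simp add: apath_def)
  \<comment> \<open>By distinctness the heads of arcs of \<open>q\<close> differ from
    \<open>s\<close> and \<open>t\<close>, the only vertices of \<open>P\<close> in
    \<open>S\<close>.\<close>
  have "head G ` set q \<inter> S = {}"
    using P(5) distinct unfolding verts by auto
  then have inv: "s \<in> ?R (tail G a) \<or> 2 \<le> card (?R (tail G a))"
    using assms(1) P(3) stable w qa by (intro rainbow_sources_along_walk[of S s F P q]) auto
  \<comment> \<open>Either \<open>s\<close> serves, as distinctness gives
    \<open>s \<noteq> t\<close>, or there are two sources and one of them is not \<open>t\<close>.
    This is why truncation at 2 suffices.\<close>
  obtain x where "x \<in> ?R (tail G a)" "x \<noteq> t"
  proof (cases "s \<in> ?R (tail G a)")
    case True
    then show ?thesis
      using that distinct by auto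
  next
    case False
    with inv have "\<not> ?R (tail G a) \<subseteq> {t}"
      using card_mono[of "{t}" "?R (tail G a)"] by auto
    then show ?thesis
      using that by blast
  qed
  then show False
    using rainbow_sources_imp_SS_path[of x S F a P] no_path a P(4) qa by auto
qed

lemma rainbow_SS_path_or_sum_sources_ge:
  assumes "finite (verts G)" and "S \<subseteq> verts G"
    and "\<And>P. P \<in> set F \<Longrightarrow> directed_SS_path G S P"
    and "\<nexists>p. directed_SS_path G S p \<and> rainbow_monotone F p"
  shows "length F \<le> (\<Sum>y \<in> verts G - S. min 2 (card (rainbow_sources S F y)))"
  using assms(3,4)
proof (induction F rule: rev_induct)
  case (snoc P F)
  let ?f = "\<lambda>F y. min 2 (card (rainbow_sources S F y))"
  have finS: "finite S"
    using assms finite_subset by blast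
  have "length F \<le> (\<Sum>y \<in> verts G - S. ?f F y)"
    \<comment> \<open>A path that is rainbow-monotone for \<open>F\<close> is so for
      \<open>F @ [P]\<close>, hence the absence of such paths passes down to
      \<open>F\<close>.\<close>
    using snoc.prems by (intro snoc.IH) (auto dest: rainbow_monotone_append_family[of F _ "[P]"])
  also have "\<dots> < (\<Sum>y \<in> verts G - S. ?f (F @ [P]) y)"
  proof (rule sum_strict_mono_ex1)
    show "\<forall>y \<in> verts G - S. ?f F y \<le> ?f (F @ [P]) y"
      using finS rainbow_sources_append_family rainbow_sources_subset
      by (metis card_mono finite_subset min.mono order_refl)
    show "\<exists>y \<in> verts G - S. ?f F y < ?f (F @ [P]) y"
      using finS snoc.prems by (intro rainbow_SS_path_or_sources_grow) auto
  qed (use assms in simp)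
  finally show ?case
    by simp
qed simp

end

theorem theorem1p8:
  fixes G :: "('a, 'b) pre_digraph" and S Y :: "'a set" and F :: "'b list list"
  assumes "graph G"
    and "S \<union> Y = verts G" and "S \<inter> Y = {}"
    and "length F = 2 * card Y + 1"
    and "\<And>P. P \<in> set F \<Longrightarrow> directed_SS_path G S P"
  shows "\<exists>P. directed_SS_path G S P \<and> rainbow_monotone F P"
proof (rule ccontr)
  assume no_path: "\<not> ?thesis"
  interpret graph G by fact
  have Y: "verts G - S = Y"
    using assms(2,3) by blast
  have "length F \<le> (\<Sum>y \<in> verts G - S. min 2 (card (rainbow_sources S F y)))"
    using assms no_path by (intro rainbow_SS_path_or_sum_sources_ge) auto
  \<comment> \<open>Truncation caps each summand at 2, so the sum cannot reach the length
    \<open>2 * card Y + 1\<close>.\<close>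
  also have "\<dots> \<le> (\<Sum>y \<in> verts G - S. 2)"
    by (intro sum_mono) simp
  also have "\<dots> = 2 * card Y"
    by (simp add: Y)
  finally show False
    using assms(4) by simp
qed

end
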